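(* Let $f: X \to Y$ be a normal mapping. Then for any open $\mathcal{O} \subset Y$, any pair of disjoint subsets $F$ and $T$ closed in $f^{-1}\mathcal{O}$, and any point $y \in \mathcal{O}$, there is a consistent family of binary partitions $\{\mathcal{O}_{n}, \{U_{n}^{k}\mid k\in\overline{0, 2^{n}-1}\}\mid n\in \omega_0\}$ of the mapping $f: X \to Y$ at $y$ such that for any $n \in \mathbb{N}$ (a) $F\cap f^{-1}\mathcal{O}_n\subset U_{n}^{0}$ and $T\cap f^{-1}\mathcal{O}_n\subset U_{n}^{2^{n}-1}$; (b) $F\cap \mathrm{cl}_{f^{-1}\mathcal{O}_n}\big(\bigcup_{k=1}^{2^{n}-1} U_{n}^{k}\big)=\varnothing$ and $\mathrm{cl}_{f^{-1}\mathcal{O}_n}\big(\bigcup_{k=0}^{2^{n}-2} U_{n}^{k}\big) \cap T = \varnothing$.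
   Context: All spaces are topological spaces; mappings $f:X\to Y$ are continuous; neighborhoods are open. $\mathbb{N}=\{1,2,\dots\}$, $\omega_0=\{0\}\cup\mathbb N$, and $\overline{a,b}$ denotes the integers $a,\dots,b$. $\mathrm{cl}_Z$ is closure in the subspace $Z$. A mapping $f:X\to Y$ is prenormal if for any two disjoint closed subsets $A,B$ of $X$ every point $y\in Y$ has a neighborhood $\mathcal{O}y$ such that $A\cap f^{-1}\mathcal{O}y$ and $B\cap f^{-1}\mathcal{O}y$ have disjoint neighborhoods in $f^{-1}\mathcal{O}y$. The mapping $f$ is normal if for every open $\mathcal{O}\subset Y$ the restriction $f_{\mathcal{O}}: f^{-1}\mathcal{O}\to\mathcal{O}$ is prenormal. A partition $U^0,\dots,U^{k-1}$ of a space $Z$ (pairwise disjoint, possibly empty sets covering $Z$) is a regular $k$-partition if (1) $\bigcup_{m=0}^{p}U^m$ is closed in $Z$ for $p\in\overline{0,k-1}$; (2) when $k\ge 3$, $\big(\bigcup_{m=0}^{p}U^m\big)\cap\mathrm{cl}\big(\bigcup_{m=p+2}^{k-1}U^m\big)=\varnothing$ for $p\in\overline{0,k-3}$. For $f:X\to Y$ and $y\in Y$, a sequence of neighborhoods $\{\mathcal{O}_n\}_{n\in\omega_0}$ of $y$ with $\mathcal{O}_0=Y$, $\mathcal{O}_{n+1}\subset\mathcal{O}_n$, together with regular $2^n$-partitions $\{U_n^k\mid k\in\overline{0,2^n-1}\}$ of the subspaces $f^{-1}\mathcal{O}_n$, $n\in\omega_0$, is a consistent family of binary partitions of $f$ at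 $y$ if $U_{n+1}^{2k}\cup U_{n+1}^{2k+1}=U_n^k\cap f^{-1}\mathcal{O}_{n+1}$ for all $n\in\omega_0$ and $k\in\overline{0,2^n-1}$. *)

theory Defs
  imports "HOL-Analysis.Analysis"
begin

abbreviation preimage :: "'a topology \<Rightarrow> ('a \<Rightarrow> 'b) \<Rightarrow> 'b set \<Rightarrow> 'a set" where
  "preimage X f V \<equiv> {x \<in> topspace X. f x \<in> V}"

definition prenormal_map :: "'a topology \<Rightarrow> 'b topology \<Rightarrow> ('a \<Rightarrow> 'b) \<Rightarrow> bool" where
  "prenormal_map X Y f \<longleftrightarrow> continuous_map X Y f \<and>
    (\<forall>A B. closedin X A \<and> closedin X B \<and> disjnt A B \<longrightarrow>
      (\<forall>y \<in> topspace Y. \<exists>V. openin Y V \<and> y \<in> V \<and>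
        (\<exists>G H. openin (subtopology X (preimage X f V)) G \<and>
               openin (subtopology X (preimage X f V)) H \<and>
               A \<inter> preimage X f V \<subseteq> G \<and> B \<inter> preimage X f V \<subseteq> H \<and> disjnt G H)))"

definition normal_map :: "'a topology \<Rightarrow> 'b topology \<Rightarrow> ('a \<Rightarrow> 'b) \<Rightarrow> bool" where
  "normal_map X Y f \<longleftrightarrow> continuous_map X Y f \<and>
    (\<forall>V. openin Y V \<longrightarrow>
      prenormal_map (subtopology X (preimage X f V)) (subtopology Y V) f)"

text \<open>A \<open>k\<close>-partition is given by a family indexed by all natural numbers, of which only the
  members with index below \<open>k\<close> are relevant.\<close>

definition regular_partition :: "'a topology \<Rightarrow> nat \<Rightarrow> (nat \<Rightarrow> 'a set) \<Rightarrow> bool" where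
  "regular_partition Z k U \<longleftrightarrow>
    1 \<le> k \<and>
    disjoint_family_on U {0..k - 1} \<and>
    (\<Union>m\<in>{0..k - 1}. U m) = topspace Z \<and>
    (\<forall>p\<in>{0..k - 1}. closedin Z (\<Union>m\<in>{0..p}. U m)) \<and>
    (3 \<le> k \<longrightarrow> (\<forall>p\<in>{0..k - 3}.
      (\<Union>m\<in>{0..p}. U m) \<inter> (Z closure_of (\<Union>m\<in>{p + 2..k - 1}. U m)) = {}))"

text \<open>The set \<open>U n k\<close> is the member with lower index \<open>n\<close> and upper index \<open>k\<close>.\<close>

definition consistent_binary_partitions ::
  "'a topology \<Rightarrow> 'b topology \<Rightarrow> ('a \<Rightarrow> 'b) \<Rightarrow> 'b \<Rightarrow> (nat \<Rightarrow> 'b set) \<Rightarrow> (nat \<Rightarrow> nat \<Rightarrow> 'a set) \<Rightarrow> bool"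
where
  "consistent_binary_partitions X Y f y N U \<longleftrightarrow>
    (\<forall>n. openin Y (N n) \<and> y \<in> N n) \<and>
    N 0 = topspace Y \<and>
    (\<forall>n. N (Suc n) \<subseteq> N n) \<and>
    (\<forall>n. regular_partition (subtopology X (preimage X f (N n))) (2 ^ n) (U n)) \<and>
    (\<forall>n. \<forall>k\<in>{0..2 ^ n - 1}.
      U (Suc n) (2 * k) \<union> U (Suc n) (2 * k + 1) = U n k \<inter> preimage X f (N (Suc n)))"

end

theory Submission
  imports Defs
begin

text \<open>
  The proof runs the construction from Urysohn's lemma along a shrinking sequence of
  neighbourhoods of \<open>y\<close>. A regular \<open>k\<close>-partition of a space \<open>Z\<close> is the same thing as a chain
  \<open>{} = B 0 \<subseteq> B 1 \<subseteq> \<dots> \<subseteq> B k = Z\<close> of closed sets, each contained in the interior of the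
  next: the members of the partition are the differences \<open>B (m + 1) - B m\<close>
  (\<open>regular_partition_of_chain\<close>). In this language, passing from \<open>U n\<close> to \<open>U (n + 1)\<close> means
  putting one new closed set between any two neighbours of the chain.

  Normality of \<open>f\<close> allows this after a shrinking of the neighbourhood: a closed set inside
  an open set can be separated from the complement of the latter over a smaller neighbourhood
  of \<open>y\<close>, which gives a closed set between the two (\<open>normal_map_sandwich\<close>). A chain is finite,
  so one neighbourhood serves all of its gaps (\<open>refine_separating_chain\<close>).

  The sets \<open>F\<close> and \<open>T\<close> are built in by taking chains that start with \<open>F\<close> instead of \<open>{}\<close> and
  end with the complement of \<open>T\<close> instead of the whole space (\<open>separating_chain\<close>). The two end
  gaps are then filled by the same rule as the others, and the conditions on \<open>F\<close> and \<open>T\<close> say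
  only that the first inclusion and the last one of the chain are into interiors.
  The ends are put back to \<open>{}\<close> and the whole space once the sequence of chains has been built.
\<close>

section \<open>Interpolation over smaller neighbourhoods\<close>

lemma openin_preimage:
  assumes "continuous_map X Y f" "openin Y V"
  shows "openin X (preimage X f V)"
  using assms openin_continuous_map_preimage by blast

lemma preimage_mono: "V \<subseteq> W \<Longrightarrow> preimage X f V \<subseteq> preimage X f W"
  by auto

text \<open>
  Apply prenormality over \<open>W\<close> to \<open>A\<close> and the complement of \<open>G\<close>; the interpolating set \<open>C\<close> is the
  complement of the neighbourhood found for the latter. Since preimages of open sets are
  open in \<open>X\<close>, interiors may be taken in \<open>X\<close> throughout, so that they do not depend on the
  neighbourhood of \<open>y\<close> in use.
\<close>

lemma normal_map_sandwich:
  assumes f: "normal_map X Y f" and W: "openin Y W" "y \<in> W"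
    and A: "closedin (subtopology X (preimage X f W)) A"
    and G: "openin X G" "A \<subseteq> G"
  shows "\<exists>M C. openin Y M \<and> y \<in> M \<and> M \<subseteq> W \<and>
    closedin (subtopology X (preimage X f M)) C \<and>
    A \<inter> preimage X f M \<subseteq> X interior_of C \<and> C \<subseteq> G"
proof -
  let ?ZW = "preimage X f W"
  have cont: "continuous_map X Y f"
    and pre: "prenormal_map (subtopology X ?ZW) (subtopology Y W) f"
    using f W by (auto simp: normal_map_def)
  have Wsub: "W \<subseteq> topspace Y" using W openin_subset by blast
  have B: "closedin (subtopology X ?ZW) (?ZW - G)"
    unfolding closedin_subtopology
    by (rule exI[of _ "topspace X - G"]) (use G(1) in auto)
  have "disjnt A (?ZW - G)" using G by (auto simp: disjnt_def)
  moreover have "y \<in> topspace (subtopology Y W)" using W Wsub by auto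
  ultimately obtain M G1 H where M: "openin (subtopology Y W) M" "y \<in> M"
    and GH: "openin (subtopology (subtopology X ?ZW) (preimage (subtopology X ?ZW) f M)) G1"
      "openin (subtopology (subtopology X ?ZW) (preimage (subtopology X ?ZW) f M)) H"
      "A \<inter> preimage (subtopology X ?ZW) f M \<subseteq> G1"
      "(?ZW - G) \<inter> preimage (subtopology X ?ZW) f M \<subseteq> H" "disjnt G1 H"
    using pre A B unfolding prenormal_map_def by meson
  let ?Z = "preimage X f M"
  have MY: "openin Y M" "M \<subseteq> W"
    using M W openin_open_subtopology by blast+
  have eq: "preimage (subtopology X ?ZW) f M = ?Z" using MY by auto
  have eq2: "subtopology (subtopology X ?ZW) ?Z = subtopology X ?Z"
    using MY(2) by (simp add: subtopology_subtopology preimage_mono inf.absorb2 Int_absorb1)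
  note GH = GH[unfolded eq eq2]
  have Z: "openin X ?Z" by (rule openin_preimage[OF cont MY(1)])
  have G1: "openin X G1" "G1 \<subseteq> ?Z"
    using GH(1) Z openin_open_subtopology by blast+
  have "A \<inter> ?Z \<subseteq> X interior_of (?Z - H)"
  proof (rule subset_trans[OF GH(3)])
    show "G1 \<subseteq> X interior_of (?Z - H)"
      using G1 GH(5) by (intro interior_of_maximal) (auto simp: disjnt_def)
  qed
  moreover have "closedin (subtopology X ?Z) (?Z - H)"
    using closedin_diff[OF closedin_topspace GH(2)] by (simp add: Int_absorb1)
  moreover have "?Z - H \<subseteq> G" using GH(4) MY(2) by blast
  ultimately show ?thesis using MY M(2) by blast
qed

lemma common_neighbourhood:
  fixes n :: nat
  assumes "openin Y W" "y \<in> W"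
    and "\<And>j. j < n \<Longrightarrow> \<exists>M. openin Y M \<and> y \<in> M \<and> M \<subseteq> W \<and> P j M"
    and "\<And>j M M'. P j M \<Longrightarrow> openin Y M' \<Longrightarrow> M' \<subseteq> M \<Longrightarrow> P j M'"
  shows "\<exists>M. openin Y M \<and> y \<in> M \<and> M \<subseteq> W \<and> (\<forall>j<n. P j M)"
  using assms(3)
proof (induction n)
  case 0
  then show ?case using assms(1,2) by auto
next
  case (Suc n)
  obtain M where M: "openin Y M" "y \<in> M" "M \<subseteq> W" "\<forall>j<n. P j M"
    using Suc by (meson less_SucI)
  obtain M' where M': "openin Y M'" "y \<in> M'" "M' \<subseteq> W" "P n M'"
    using Suc.prems by blast
  have o: "openin Y (M \<inter> M')" using M M' by auto
  have "P j (M \<inter> M')" if "j < Suc n" for j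
  proof (cases "j = n")
    case True
    then show ?thesis using assms(4)[OF M'(4) o] by auto
  next
    case False
    then have "P j M" using that M(4) by auto
    then show ?thesis using assms(4)[OF _ o] by auto
  qed
  then show ?case using o M M' by (intro exI[of _ "M \<inter> M'"]) auto
qed

text \<open>
  The index \<open>k\<close> is excluded from the closedness condition: the last set, the complement of \<open>T\<close>,
  is open rather than closed.
\<close>

definition separating_chain ::
  "'a topology \<Rightarrow> 'a set \<Rightarrow> 'a set \<Rightarrow> 'a set \<Rightarrow> nat \<Rightarrow> (nat \<Rightarrow> 'a set) \<Rightarrow> bool"
where
  "separating_chain X Z F T k A \<longleftrightarrow>
    A 0 = F \<inter> Z \<and> A k = Z - T \<and>
    (\<forall>j<k. closedin (subtopology X Z) (A j) \<and> A j \<subseteq> X interior_of A (Suc j))"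

text \<open>
  The old chain goes to the even places and the interpolating sets to the odd ones. An
  interpolating set still interpolates when both it and the chain are cut down to a smaller
  neighbourhood, so the neighbourhoods found for the single gaps can be intersected.
\<close>

lemma refine_separating_chain:
  assumes f: "normal_map X Y f" and W: "openin Y W" "y \<in> W"
    and A: "separating_chain X (preimage X f W) F T k A"
  shows "\<exists>M A'. openin Y M \<and> y \<in> M \<and> M \<subseteq> W \<and>
    separating_chain X (preimage X f M) F T (2 * k) A' \<and>
    (\<forall>j\<le>k. A' (2 * j) = A j \<inter> preimage X f M)"
proof -
  have cont: "continuous_map X Y f" using f by (simp add: normal_map_def)
  define P where "P j M \<longleftrightarrow> (\<exists>C. closedin (subtopology X (preimage X f M)) C \<and>
    A j \<inter> preimage X f M \<subseteq> X interior_of C \<and> C \<subseteq> X interior_of A (Suc j))" for j M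
  have "\<exists>M. openin Y M \<and> y \<in> M \<and> M \<subseteq> W \<and> (\<forall>j<k. P j M)"
  proof (rule common_neighbourhood[OF W])
    fix j assume "j < k"
    then have "closedin (subtopology X (preimage X f W)) (A j)" "A j \<subseteq> X interior_of A (Suc j)"
      using A by (auto simp: separating_chain_def)
    from normal_map_sandwich[OF f W this(1) openin_interior_of this(2)]
    show "\<exists>M. openin Y M \<and> y \<in> M \<and> M \<subseteq> W \<and> P j M"
      unfolding P_def by blast
  next
    fix j M M' assume "P j M" and M': "openin Y M'" "M' \<subseteq> M"
    then obtain C where C: "closedin (subtopology X (preimage X f M)) C"
      "A j \<inter> preimage X f M \<subseteq> X interior_of C" "C \<subseteq> X interior_of A (Suc j)"
      unfolding P_def by blast
    let ?Z = "preimage X f M'"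
    have Z: "X interior_of ?Z = ?Z"
      using openin_preimage[OF cont M'(1)] by (simp add: interior_of_openin)
    have sub: "?Z \<subseteq> preimage X f M" by (rule preimage_mono[OF M'(2)])
    have "closedin (subtopology X ?Z) (C \<inter> ?Z)"
      using C(1) sub by (auto simp: closedin_subtopology)
    moreover have "A j \<inter> ?Z \<subseteq> X interior_of (C \<inter> ?Z)"
      unfolding interior_of_Int Z using C(2) sub by blast
    ultimately show "P j M'" using C(3) unfolding P_def by blast
  qed
  then obtain M where M: "openin Y M" "y \<in> M" "M \<subseteq> W" and P: "\<forall>j<k. P j M" by blast
  have "\<forall>j. \<exists>C. j < k \<longrightarrow> closedin (subtopology X (preimage X f M)) C \<and>
      A j \<inter> preimage X f M \<subseteq> X interior_of C \<and> C \<subseteq> X interior_of A (Suc j)"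
    using P unfolding P_def by blast
  from choice[OF this] obtain C where C: "\<And>j. j < k \<Longrightarrow> closedin (subtopology X (preimage X f M)) (C j)"
    "\<And>j. j < k \<Longrightarrow> A j \<inter> preimage X f M \<subseteq> X interior_of C j"
    "\<And>j. j < k \<Longrightarrow> C j \<subseteq> X interior_of A (Suc j)"
    by blast
  let ?Z = "preimage X f M"
  have Z: "X interior_of ?Z = ?Z"
    using openin_preimage[OF cont M(1)] by (simp add: interior_of_openin)
  have sub: "?Z \<subseteq> preimage X f W" by (rule preimage_mono[OF M(3)])
  have CZ: "C j \<subseteq> ?Z" if "j < k" for j
    using closedin_subset[OF C(1)[OF that]] by auto
  define A' where "A' i = (if even i then A (i div 2) \<inter> ?Z else C (i div 2))" for i
  have ev: "A' (2 * j) = A j \<inter> ?Z" and od: "A' (Suc (2 * j)) = C j" for j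
    by (auto simp: A'_def)
  have step: "closedin (subtopology X ?Z) (A' i) \<and> A' i \<subseteq> X interior_of A' (Suc i)"
    if i: "i < 2 * k" for i
  proof (cases "even i")
    case True
    then obtain j where j: "i = 2 * j" by blast
    with i have jk: "j < k" by auto
    have "closedin (subtopology X (preimage X f W)) (A j)"
      using A jk by (simp add: separating_chain_def)
    then have "closedin (subtopology X ?Z) (A j \<inter> ?Z)"
      using sub by (auto simp: closedin_subtopology)
    then show ?thesis using C(2)[OF jk] by (simp only: j ev od)
  next
    case False
    then obtain j where j: "i = Suc (2 * j)" by (metis oddE Suc_eq_plus1)
    with i have jk: "j < k" by auto
    have nxt: "A' (Suc (Suc (2 * j))) = A (Suc j) \<inter> ?Z" using ev[of "Suc j"] by simp
    have "C j \<subseteq> X interior_of (A (Suc j) \<inter> ?Z)"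
      unfolding interior_of_Int Z using C(3)[OF jk] CZ[OF jk] by blast
    then show ?thesis using C(1)[OF jk] by (simp only: nxt j od simp_thms)
  qed
  have "A' 0 = F \<inter> ?Z" "A' (2 * k) = ?Z - T"
    using ev[of 0] ev[of k] A sub by (auto simp: separating_chain_def)
  with step have "separating_chain X ?Z F T (2 * k) A'"
    by (simp add: separating_chain_def)
  with M ev show ?thesis by blast
qed

section \<open>Regular partitions as chains of closed sets\<close>

lemma chain_mono:
  fixes B :: "nat \<Rightarrow> 'a set"
  assumes "i \<le> j" "j \<le> k" and "\<And>l. l < k \<Longrightarrow> B l \<subseteq> B (Suc l)"
  shows "B i \<subseteq> B j"
  using assms
proof (induction j rule: dec_induct)
  case (step j)
  then have "B i \<subseteq> B j" "B j \<subseteq> B (Suc j)" by auto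
  then show ?case by blast
qed auto

lemma Union_increments:
  fixes B :: "nat \<Rightarrow> 'a set"
  assumes "p \<le> q" and "\<And>j. j < q \<Longrightarrow> B j \<subseteq> B (Suc j)"
  shows "(\<Union>m\<in>{p..<q}. B (Suc m) - B m) = B q - B p"
  using assms
proof (induction q rule: dec_induct)
  case (step q)
  have "B p \<subseteq> B q"
    using chain_mono[of p q "Suc q" B] step.hyps step.prems by simp
  moreover have "B q \<subseteq> B (Suc q)" using step.prems by blast
  moreover have "(\<Union>m\<in>{p..<q}. B (Suc m) - B m) = B q - B p"
    using step by auto
  ultimately show ?case using step.hyps by (auto simp: atLeastLessThanSuc)
qed auto

text \<open>
  Unions of initial members telescope to sets of the chain, and unions of final members to
  complements of such sets. The closure of the complement of \<open>B (p + 2)\<close> is the complement of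
  its interior, hence misses \<open>B (p + 1)\<close>; this is the second condition on regular partitions.
\<close>

lemma regular_partition_of_chain:
  assumes k: "1 \<le> k" and B0: "B 0 = {}" and Bk: "B k = topspace Z"
    and cl: "\<And>j. j \<le> k \<Longrightarrow> closedin Z (B j)"
    and int: "\<And>j. j < k \<Longrightarrow> B j \<subseteq> Z interior_of B (Suc j)"
  shows "regular_partition Z k (\<lambda>m. B (Suc m) - B m)"
proof -
  have mono: "B j \<subseteq> B (Suc j)" if "j < k" for j
    by (rule subset_trans[OF int[OF that] interior_of_subset])
  have mono_le: "B i \<subseteq> B j" if "i \<le> j" "j \<le> k" for i j
    by (rule chain_mono[OF that]) (rule mono)
  have initial: "(\<Union>m\<in>{0..p}. B (Suc m) - B m) = B (Suc p)" if "p < k" for p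
    using Union_increments[of 0 "Suc p" B] mono that B0
    by (simp add: atLeastLessThanSuc_atLeastAtMost)
  have final: "(\<Union>m\<in>{p..k - 1}. B (Suc m) - B m) = topspace Z - B p" if "p \<le> k" for p
  proof -
    have "{p..k - 1} = {p..<k}" using k by auto
    then show ?thesis using Union_increments[of p k B] mono that Bk by simp
  qed
  have "disjoint_family_on (\<lambda>m. B (Suc m) - B m) {0..k - 1}"
  proof -
    have "(B (Suc m) - B m) \<inter> (B (Suc n) - B n) = {}" if "m < n" "n < k" for m n
      using mono_le[of "Suc m" n] that by auto
    then have "(B (Suc m) - B m) \<inter> (B (Suc n) - B n) = {}" if "m \<noteq> n" "m < k" "n < k" for m n
      using that by (cases m n rule: linorder_cases) blast+
    then show ?thesis using k by (auto simp: disjoint_family_on_def)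
  qed
  moreover have "(\<Union>m\<in>{0..k - 1}. B (Suc m) - B m) = topspace Z"
    using final[of 0] B0 by simp
  moreover have "closedin Z (\<Union>m\<in>{0..p}. B (Suc m) - B m)" if "p \<in> {0..k - 1}" for p
    using that k initial[of p] cl[of "Suc p"] by auto
  moreover have "(\<Union>m\<in>{0..p}. B (Suc m) - B m) \<inter>
      Z closure_of (\<Union>m\<in>{p + 2..k - 1}. B (Suc m) - B m) = {}"
    if "3 \<le> k" "p \<in> {0..k - 3}" for p
  proof -
    have p: "Suc p < k" "p + 2 \<le> k" using that by auto
    show ?thesis
      using int[OF p(1)] initial[of p] final[OF p(2)] p by (auto simp: closure_of_complement)
  qed
  ultimately show ?thesis using k by (simp add: regular_partition_def)
qed

section \<open>The sequence of partitions\<close>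

text \<open>
  The construction starts over \<open>V\<close>, where \<open>F\<close> and \<open>T\<close> are closed: that \<open>F\<close> lies in the open
  complement of \<open>T\<close> makes these two sets a chain with a single gap.
\<close>

lemma sequence_of_chains:
  assumes f: "normal_map X Y f" and V: "openin Y V" "y \<in> V"
    and F: "closedin (subtopology X (preimage X f V)) F"
    and T: "closedin (subtopology X (preimage X f V)) T" and FT: "disjnt F T"
  obtains M A where "\<And>n. openin Y (M n)" "\<And>n. y \<in> M n" "\<And>n. M (Suc n) \<subseteq> M n"
    "\<And>n. separating_chain X (preimage X f (M n)) F T (2 ^ n) (A n)"
    "\<And>n j. j \<le> 2 ^ n \<Longrightarrow> A (Suc n) (2 * j) = A n j \<inter> preimage X f (M (Suc n))"
proof -
  define Inv where "Inv n S \<longleftrightarrow> (case S of (M, A) \<Rightarrow> openin Y M \<and> y \<in> M \<and>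
    separating_chain X (preimage X f M) F T (2 ^ n) A)" for n :: nat and S :: "'b set \<times> (nat \<Rightarrow> 'a set)"
  define Ref where "Ref n S S' \<longleftrightarrow> (case S of (M, A) \<Rightarrow> case S' of (M', A') \<Rightarrow> M' \<subseteq> M \<and>
    (\<forall>j\<le>2 ^ n. A' (2 * j) = A j \<inter> preimage X f M'))"
    for n :: nat and S S' :: "'b set \<times> (nat \<Rightarrow> 'a set)"
  have "\<exists>S. \<forall>n. Inv n (S n) \<and> Ref n (S n) (S (Suc n))"
  proof (rule dependent_nat_choice)
    let ?Z = "preimage X f V"
    have Z: "openin X ?Z" using openin_preimage f V(1) by (auto simp: normal_map_def)
    have "openin (subtopology X ?Z) (?Z - T)"
      using openin_diff[OF openin_topspace T] by (simp add: Int_absorb1)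
    then have "openin X (?Z - T)" using Z openin_open_subtopology by blast
    moreover have sub: "F \<subseteq> ?Z" using closedin_subset[OF F] by auto
    ultimately have "F \<subseteq> X interior_of (?Z - T)"
      using FT by (auto simp: interior_of_openin disjnt_def)
    then have "separating_chain X ?Z F T 1 (\<lambda>j. if j = 0 then F else ?Z - T)"
      using F sub by (auto simp: separating_chain_def)
    then show "\<exists>S. Inv 0 S" using V by (auto simp: Inv_def)
  next
    fix S n assume S: "Inv n S"
    obtain M A where eq: "S = (M, A)" by (cases S)
    obtain M' A' where "openin Y M'" "y \<in> M'" "M' \<subseteq> M"
      "separating_chain X (preimage X f M') F T (2 * 2 ^ n) A'"
      "\<forall>j\<le>2 ^ n. A' (2 * j) = A j \<inter> preimage X f M'"
      using refine_separating_chain[OF f, of M y F T "2 ^ n" A] S by (auto simp: Inv_def eq)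
    then show "\<exists>S'. Inv (Suc n) S' \<and> Ref n S S'"
      by (intro exI[of _ "(M', A')"]) (simp add: Inv_def Ref_def eq)
  qed
  then obtain S where S: "\<And>n. Inv n (S n)" "\<And>n. Ref n (S n) (S (Suc n))" by blast
  show thesis
  proof (rule that[of "\<lambda>n. fst (S n)" "\<lambda>n. snd (S n)"])
    fix n
    show "openin Y (fst (S n))" "y \<in> fst (S n)"
      "separating_chain X (preimage X f (fst (S n))) F T (2 ^ n) (snd (S n))"
      using S(1)[of n] unfolding Inv_def case_prod_beta by blast+
    show "fst (S (Suc n)) \<subseteq> fst (S n)"
      using S(2)[of n] unfolding Ref_def case_prod_beta by blast
    fix j :: nat assume "j \<le> 2 ^ n"
    then show "snd (S (Suc n)) (2 * j) = snd (S n) j \<inter> preimage X f (fst (S (Suc n)))"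
      using S(2)[of n] unfolding Ref_def case_prod_beta by blast
  qed
qed

theorem lemma3p1:
  fixes X :: "'a topology" and Y :: "'b topology" and f :: "'a \<Rightarrow> 'b"
    and V :: "'b set" and F T :: "'a set" and y :: 'b
  assumes "normal_map X Y f"
    and "openin Y V"
    and "closedin (subtopology X (preimage X f V)) F"
    and "closedin (subtopology X (preimage X f V)) T"
    and "disjnt F T"
    and "y \<in> V"
  shows "\<exists>N U. consistent_binary_partitions X Y f y N U \<and>
    (\<forall>n\<ge>1.
      F \<inter> preimage X f (N n) \<subseteq> U n 0 \<and>
      T \<inter> preimage X f (N n) \<subseteq> U n (2 ^ n - 1) \<and>
      F \<inter> (subtopology X (preimage X f (N n)) closure_of (\<Union>k\<in>{1..2 ^ n - 1}. U n k)) = {} \<and>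
      (subtopology X (preimage X f (N n)) closure_of (\<Union>k\<in>{0..2 ^ n - 2}. U n k)) \<inter> T = {})"
proof -
  have cont: "continuous_map X Y f" using assms(1) by (simp add: normal_map_def)
  obtain M A where M: "\<And>n. openin Y (M n)" "\<And>n. y \<in> M n" "\<And>n. M (Suc n) \<subseteq> M n"
    and A: "\<And>n. separating_chain X (preimage X f (M n)) F T (2 ^ n) (A n)"
    and A_double: "\<And>n j. j \<le> 2 ^ n \<Longrightarrow> A (Suc n) (2 * j) = A n j \<inter> preimage X f (M (Suc n))"
    by (rule sequence_of_chains[OF assms(1,2,6,3,4,5)]) blast
  \<comment> \<open>The family has to begin with all of \<open>Y\<close>, the chains with \<open>V\<close>. Both fit because the
    partition of index 0 has a single member, so it does not involve the chain of index 0.\<close>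
  define N where "N n = (if n = 0 then topspace Y else M n)" for n
  let ?Z = "\<lambda>n. preimage X f (N n)"
  define B where "B n j = (if j = 0 then {} else if j < 2 ^ n then A n j else ?Z n)" for n j :: nat
  define U where "U n k = B n (Suc k) - B n k" for n k
  have N: "openin Y (N n)" "y \<in> N n" "N (Suc n) \<subseteq> N n" for n
    using M openin_subset[OF M(1)[of n]] openin_subset[OF M(1)[of "Suc n"]] M(2)[of n]
    unfolding N_def by (simp_all add: subset_iff)
  have Zopen: "openin X (?Z n)" for n by (rule openin_preimage[OF cont N(1)])
  have Zsub: "?Z (Suc n) \<subseteq> ?Z n" for n by (rule preimage_mono[OF N(3)])
  have topZ: "topspace (subtopology X (?Z n)) = ?Z n" for n by auto
  have chain: "A n 0 = F \<inter> ?Z n" "A n (2 ^ n) = ?Z n - T"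
    "\<And>j. j < 2 ^ n \<Longrightarrow> closedin (subtopology X (?Z n)) (A n j)"
    "\<And>j. j < 2 ^ n \<Longrightarrow> A n j \<subseteq> subtopology X (?Z n) interior_of A n (Suc j)" if "1 \<le> n" for n
  proof -
    have eq: "M n = N n" using that by (simp add: N_def)
    note A' = A[of n, unfolded eq separating_chain_def]
    show "A n 0 = F \<inter> ?Z n" "A n (2 ^ n) = ?Z n - T" using A' by blast+
    fix j :: nat assume j: "j < 2 ^ n"
    show cl: "closedin (subtopology X (?Z n)) (A n j)" using A' j by blast
    have "A n j \<subseteq> ?Z n" using closedin_subset[OF cl] by auto
    then show "A n j \<subseteq> subtopology X (?Z n) interior_of A n (Suc j)"
      using A' j by (auto simp: interior_of_subtopology_open[OF Zopen])
  qed
  have B_closed: "closedin (subtopology X (?Z n)) (B n j)" for n j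
  proof (cases "j = 0 \<or> 2 ^ n \<le> j")
    case True
    then show ?thesis
      using closedin_topspace[of "subtopology X (?Z n)"] unfolding topZ by (auto simp: B_def)
  next
    case False
    then have "1 \<le> n" by (cases n) auto
    then show ?thesis using False chain(3) by (auto simp: B_def)
  qed
  have B_interior: "B n j \<subseteq> subtopology X (?Z n) interior_of B n (Suc j)" if j: "j < 2 ^ n" for n j
  proof (cases "j = 0 \<or> Suc j = 2 ^ n")
    case True
    have "subtopology X (?Z n) interior_of ?Z n = ?Z n"
      using interior_of_topspace[of "subtopology X (?Z n)"] unfolding topZ .
    then show ?thesis using True closedin_subset[OF B_closed[of n j]] unfolding topZ
      by (auto simp: B_def)
  next
    case False
    then have "1 \<le> n" using j by (cases n) auto
    then show ?thesis using False j chain(4)[of n j] by (auto simp: B_def)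
  qed
  have B_mono: "B n j \<subseteq> B n (Suc j)" if "j < 2 ^ n" for n j
    by (rule subset_trans[OF B_interior[OF that] interior_of_subset])
  \<comment> \<open>For \<open>n = 0\<close> only the two ends of the chain occur, so the change of \<open>N 0\<close> does no harm.\<close>
  have B_double: "B (Suc n) (2 * j) = B n j \<inter> ?Z (Suc n)" if "j \<le> 2 ^ n" for n j
    using A_double[OF that] Zsub[of n] by (auto simp: B_def N_def)
  have regular: "regular_partition (subtopology X (?Z n)) (2 ^ n) (U n)" for n
    unfolding U_def
    by (rule regular_partition_of_chain) (use topZ B_closed B_interior in \<open>auto simp: B_def\<close>)
  have split: "U (Suc n) (2 * k) \<union> U (Suc n) (2 * k + 1) = U n k \<inter> ?Z (Suc n)" if k: "k < 2 ^ n" for n k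
  proof -
    have "B (Suc n) (2 * k) \<subseteq> B (Suc n) (2 * k + 1)" "B (Suc n) (2 * k + 1) \<subseteq> B (Suc n) (2 * Suc k)"
      using B_mono[of "2 * k" "Suc n"] B_mono[of "2 * k + 1" "Suc n"] k by auto
    then have "U (Suc n) (2 * k) \<union> U (Suc n) (2 * k + 1) = B (Suc n) (2 * Suc k) - B (Suc n) (2 * k)"
      by (auto simp: U_def)
    then show ?thesis using B_double[of k n] B_double[of "Suc k" n] k by (auto simp: U_def)
  qed
  have less: "k < 2 ^ n" if "k \<in> {0..2 ^ n - 1}" for k n :: nat
  proof -
    have "0 < (2::nat) ^ n" by simp
    moreover have "k \<le> 2 ^ n - 1" using that by simp
    ultimately show ?thesis by linarith
  qed
  have "consistent_binary_partitions X Y f y N U"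
    unfolding consistent_binary_partitions_def
    using N regular split less by (auto simp: N_def)
  moreover have "F \<inter> ?Z n \<subseteq> U n 0 \<and> T \<inter> ?Z n \<subseteq> U n (2 ^ n - 1) \<and>
      F \<inter> (subtopology X (?Z n) closure_of (\<Union>k\<in>{1..2 ^ n - 1}. U n k)) = {} \<and>
      (subtopology X (?Z n) closure_of (\<Union>k\<in>{0..2 ^ n - 2}. U n k)) \<inter> T = {}" if n: "1 \<le> n" for n
  proof -
    let ?X = "subtopology X (?Z n)" and ?k = "2 ^ n :: nat"
    have k: "2 \<le> ?k" using power_increasing[OF n, of "2::nat"] by simp
    have F_int: "F \<inter> ?Z n \<subseteq> ?X interior_of B n 1"
      using chain(1)[OF n] chain(4)[OF n, of 0] k by (simp add: B_def)
    have B_last: "B n (?k - 1) \<subseteq> ?Z n - T"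
    proof -
      have last: "?k - 1 < ?k" "Suc (?k - 1) = ?k" using k by auto
      have "A n (?k - 1) \<subseteq> ?X interior_of (?Z n - T)"
        using chain(4)[OF n last(1)] unfolding last(2) chain(2)[OF n] .
      moreover have "B n (?k - 1) = A n (?k - 1)" using k by (auto simp: B_def)
      ultimately show ?thesis
        using interior_of_subset[of ?X "?Z n - T"] by (simp only: subset_trans)
    qed
    have "{1..?k - 1} = {1..<?k}" by auto
    then have "(\<Union>k\<in>{1..?k - 1}. U n k) = topspace ?X - B n 1"
      using Union_increments[of 1 ?k "B n"] B_mono k unfolding topZ by (simp add: U_def B_def)
    then have upper: "?X closure_of (\<Union>k\<in>{1..?k - 1}. U n k) = ?Z n - ?X interior_of B n 1"
      using closure_of_complement[of ?X "B n 1"] unfolding topZ by (simp only:)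
    have "{0..?k - 2} = {0..<?k - 1}" using k by auto
    then have "(\<Union>k\<in>{0..?k - 2}. U n k) = B n (?k - 1)"
      using Union_increments[of 0 "?k - 1" "B n"] B_mono by (simp add: U_def B_def)
    then have lower: "?X closure_of (\<Union>k\<in>{0..?k - 2}. U n k) = B n (?k - 1)"
      using B_closed[of n "?k - 1"] by (simp add: closure_of_closedin)
    have "U n 0 = B n 1" "U n (?k - 1) = ?Z n - B n (?k - 1)"
      using k by (auto simp: U_def B_def)
    moreover have "?X interior_of B n 1 \<subseteq> B n 1" by (rule interior_of_subset)
    ultimately show ?thesis unfolding upper lower using F_int B_last by blast
  qed
  ultimately show ?thesis by blast
qed

end
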